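(* Let $M=\mathrm{End}(\mathbb{Q},<)$, $E=\mathrm{End}(\mathbb{Q},\le)$ and $G=\mathrm{Aut}(\mathbb{Q},<)$, so $G\subseteq M\subseteq E$. If $\xi\colon M\to E$ is an injective monoid homomorphism such that $\xi(g)=g$ for all $g\in G$, then $\xi(f)=f$ for all $f\in M$.
   Context: $\mathrm{End}(\mathbb{Q},<)$ is the monoid of strictly order-preserving maps $\mathbb{Q}\to\mathbb{Q}$, $\mathrm{End}(\mathbb{Q},\le)$ is the monoid of weakly order-preserving maps $\mathbb{Q}\to\mathbb{Q}$, and $\mathrm{Aut}(\mathbb{Q},<)$ is the group of order-automorphisms of $\mathbb{Q}$; the operation is composition. *)

theory Defs
  imports Complex_Main "HOL-Algebra.Group"
begin

definition End_less :: "(rat \<Rightarrow> rat) monoid" where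
  "End_less = \<lparr>carrier = {f. strict_mono f}, mult = (\<circ>), one = id\<rparr>"

definition End_le :: "(rat \<Rightarrow> rat) monoid" where
  "End_le = \<lparr>carrier = {f. mono f}, mult = (\<circ>), one = id\<rparr>"

definition Aut_less :: "(rat \<Rightarrow> rat) monoid" where
  "Aut_less = \<lparr>carrier = {f. bij f \<and> (\<forall>x y. x < y \<longleftrightarrow> f x < f y)}, mult = (\<circ>), one = id\<rparr>"

(* hom only asks for compatibility with the multiplication, so preservation
   of the identity has to be required separately. *)
definition monoid_hom :: "('a, 'c) monoid_scheme \<Rightarrow> ('b, 'd) monoid_scheme \<Rightarrow> ('a \<Rightarrow> 'b) set" where
  "monoid_hom A B = {h \<in> hom A B. h \<one>\<^bsub>A\<^esub> = \<one>\<^bsub>B\<^esub>}"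

lemma monoid_End_less: "monoid End_less"
  by (rule monoidI) (auto simp: End_less_def strict_mono_def)

lemma monoid_End_le: "monoid End_le"
  by (rule monoidI) (auto simp: End_le_def mono_def)

lemma group_Aut_less: "group Aut_less"
proof (rule groupI)
  fix f assume "f \<in> carrier Aut_less"
  then have f: "bij f" "\<And>x y. x < y \<longleftrightarrow> f x < f y"
    by (simp_all add: Aut_less_def)
  then have "inv_into UNIV f x < inv_into UNIV f y \<longleftrightarrow> x < y" for x y
    using f(2)[of "inv_into UNIV f x" "inv_into UNIV f y"] f(1)
    by (simp add: bij_is_surj surj_f_inv_f)
  with f show "\<exists>g\<in>carrier Aut_less. g \<otimes>\<^bsub>Aut_less\<^esub> f = \<one>\<^bsub>Aut_less\<^esub>"
    by (intro bexI[of _ "inv_into UNIV f"])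
      (auto simp: Aut_less_def bij_imp_bij_inv bij_is_inj)
qed (auto simp: Aut_less_def bij_comp)

lemma Aut_less_subset_End_less: "carrier Aut_less \<subseteq> carrier End_less"
  by (auto simp: Aut_less_def End_less_def strict_mono_def)

lemma End_less_subset_End_le: "carrier End_less \<subseteq> carrier End_le"
  by (auto simp: End_less_def End_le_def strict_mono_mono)

end

theory Submission
  imports Defs "HOL-Library.Countable_Set" "HOL-Library.Product_Lexorder"
begin

text \<open>
  Let \<open>\<rat>\<^sup>2\<close> be the lexicographic square of the rationals, identified with \<open>\<rat>\<close> by an
  order isomorphism \<open>L\<close>, and let \<open>k\<close> be an order isomorphism of \<open>\<rat>\<close> onto the rational interval
  \<open>(-1, 1)\<close>. The proof rests on the single strictly increasing map \<open>u y = L (k y, 0)\<close>. Its image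
  is bounded, each of its points lies in a copy of \<open>\<rat>\<close> of its own, and every rational strictly
  between two of these copies lies in a third one.

  First, \<open>\<xi> u = u\<close>. For each \<open>x\<close> the dilation \<open>g y = 2 y - x\<close> lifts through \<open>u\<close> to an automorphism
  \<open>H\<close> with \<open>H \<circ> u = u \<circ> g\<close>, and since there is room around every point of the image, \<open>H\<close> can be
  chosen to have no fixed point besides \<open>u x\<close> (lemma \<open>lex_expansion\<close>). Applying \<open>\<xi>\<close>, which fixes
  \<open>H\<close> and \<open>g\<close>, shows that \<open>H\<close> also fixes \<open>\<xi> u x\<close>; hence \<open>\<xi> u x = u x\<close>.

  Secondly, \<open>u\<close> is so sparse that it hides every peculiarity of a strictly increasing map \<open>f\<close>:
  for each \<open>x\<close> there are automorphisms \<open>\<theta>, \<theta>'\<close> with \<open>f \<circ> \<theta>' \<circ> u = \<theta> \<circ> u\<close> and \<open>\<theta>' (u 0) = x\<close>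
  (lemma \<open>lex_square_factorization\<close>). The reason is that \<open>f\<close> determines only countably many cuts of
  its domain (those filled by some rational of the codomain), and the image of \<open>\<theta>' \<circ> u\<close> can be
  chosen so that each of these cuts is absorbed into the neighbourhood of one of its points, or
  lies outside its range (lemma \<open>collapse_to_rationals\<close>). Applying \<open>\<xi>\<close> to the equation gives
  \<open>\<xi> f \<circ> \<theta>' \<circ> u = \<theta> \<circ> u = f \<circ> \<theta>' \<circ> u\<close>, and evaluation at \<open>0\<close> gives \<open>\<xi> f x = f x\<close>.

  All isomorphisms come from Cantor's back-and-forth theorem, in the form in which a given finite
  partial isomorphism is extended: prescribing finitely many values is what keeps control
  of the point \<open>x\<close>.
\<close>

section \<open>Cantor's theorem on countable dense orders\<close>

definition unbounded_dense :: "'a::linorder set \<Rightarrow> bool" where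
  "unbounded_dense A \<longleftrightarrow> A \<noteq> {} \<and> (\<forall>x\<in>A. \<exists>y\<in>A. y < x) \<and> (\<forall>x\<in>A. \<exists>y\<in>A. x < y)
     \<and> (\<forall>x\<in>A. \<forall>y\<in>A. x < y \<longrightarrow> (\<exists>z\<in>A. x < z \<and> z < y))"

definition partial_iso :: "'a::linorder set \<Rightarrow> 'b::linorder set \<Rightarrow> ('a \<times> 'b) set \<Rightarrow> bool" where
  "partial_iso A B p \<longleftrightarrow> finite p \<and> p \<subseteq> A \<times> B
     \<and> (\<forall>(a, b)\<in>p. \<forall>(a', b')\<in>p. a < a' \<longleftrightarrow> b < b')"

lemma partial_iso_less_iff:
  "partial_iso A B p \<Longrightarrow> (a, b) \<in> p \<Longrightarrow> (a', b') \<in> p \<Longrightarrow> a < a' \<longleftrightarrow> b < b'"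
  unfolding partial_iso_def by fast

lemma partial_iso_converse: "partial_iso A B p \<Longrightarrow> partial_iso B A (p\<inverse>)"
  unfolding partial_iso_def by fastforce

lemma unbounded_dense_between:
  assumes A: "unbounded_dense A" and "finite L" "finite U" "L \<subseteq> A" "U \<subseteq> A"
    and lt: "\<And>x y. x \<in> L \<Longrightarrow> y \<in> U \<Longrightarrow> x < y"
  shows "\<exists>z\<in>A. (\<forall>x\<in>L. x < z) \<and> (\<forall>y\<in>U. z < y)"
proof -
  consider "L = {}" "U = {}" | "L \<noteq> {}" "U = {}" | "L = {}" "U \<noteq> {}" | "L \<noteq> {}" "U \<noteq> {}"
    by blast
  then show ?thesis
  proof cases
    case 1
    then show ?thesis using A unfolding unbounded_dense_def by blast
  next
    case 2
    then have "Max L \<in> A" using assms by (meson Max_in subsetD)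
    then obtain z where "z \<in> A" "Max L < z" using A unfolding unbounded_dense_def by blast
    then show ?thesis using 2 assms by auto
  next
    case 3
    then have "Min U \<in> A" using assms by (meson Min_in subsetD)
    then obtain z where "z \<in> A" "z < Min U" using A unfolding unbounded_dense_def by blast
    then show ?thesis using 3 assms by auto
  next
    case 4
    then have "Max L \<in> A" "Min U \<in> A" "Max L < Min U"
      using assms by (meson Max_in Min_in subsetD)+
    then obtain z where "z \<in> A" "Max L < z" "z < Min U"
      using A unfolding unbounded_dense_def by blast
    then show ?thesis using 4 assms by auto
  qed
qed

text \<open>
  The image of a new point must exceed the images of the points below it and lie beneath the images
  of the points above it. These are finitely many conditions, so a dense order without end points
  can meet them.
\<close>
lemma partial_iso_extend_domain:
  assumes B: "unbounded_dense B" and p: "partial_iso A B p" and a: "a \<in> A"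
  shows "\<exists>p'. partial_iso A B p' \<and> p \<subseteq> p' \<and> a \<in> Domain p'"
proof (cases "a \<in> Domain p")
  case True
  then show ?thesis using p by blast
next
  case False
  define L where "L = snd ` {x\<in>p. fst x < a}"
  define U where "U = snd ` {x\<in>p. a < fst x}"
  have fin: "finite p" and sub: "p \<subseteq> A \<times> B" using p unfolding partial_iso_def by auto
  have "\<exists>b\<in>B. (\<forall>x\<in>L. x < b) \<and> (\<forall>y\<in>U. b < y)"
  proof (rule unbounded_dense_between[OF B])
    show "finite L" "finite U" using fin by (auto simp: L_def U_def)
    show "L \<subseteq> B" "U \<subseteq> B" using sub by (auto simp: L_def U_def)
    show "x < y" if "x \<in> L" "y \<in> U" for x y
      using that partial_iso_less_iff[OF p] unfolding L_def U_def by fastforce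
  qed
  then obtain b where b: "b \<in> B" "\<And>x. x \<in> L \<Longrightarrow> x < b" "\<And>y. y \<in> U \<Longrightarrow> b < y" by blast
  have new: "(a' < a \<longleftrightarrow> b' < b) \<and> (a < a' \<longleftrightarrow> b < b')" if "(a', b') \<in> p" for a' b'
  proof -
    have "a' \<noteq> a" using False that by blast
    then consider "a' < a" | "a < a'" by (meson linorder_less_linear)
    then show ?thesis
    proof cases
      case 1
      then have "b' \<in> L" using that unfolding L_def by force
      then show ?thesis using b(2) 1 by (meson less_asym)
    next
      case 2
      then have "b' \<in> U" using that unfolding U_def by force
      then show ?thesis using b(3) 2 by (meson less_asym)
    qed
  qed
  have "partial_iso A B (insert (a, b) p)"
    unfolding partial_iso_def
    using fin sub a b(1) new partial_iso_less_iff[OF p] by auto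
  then show ?thesis by blast
qed

lemma partial_iso_extend_range:
  assumes A: "unbounded_dense A" and p: "partial_iso A B p" and b: "b \<in> B"
  shows "\<exists>p'. partial_iso A B p' \<and> p \<subseteq> p' \<and> b \<in> Range p'"
proof -
  obtain p' where p': "partial_iso B A p'" "p\<inverse> \<subseteq> p'" "b \<in> Domain p'"
    using partial_iso_extend_domain[OF A partial_iso_converse[OF p] b] by blast
  have "partial_iso A B (p'\<inverse>)" by (rule partial_iso_converse[OF p'(1)])
  moreover have "p \<subseteq> p'\<inverse>" "b \<in> Range (p'\<inverse>)" using p' by auto
  ultimately show ?thesis by blast
qed

text \<open>
  The finite partial isomorphisms are extended alternately, the \<open>n\<close>-th step adding the \<open>n\<close>-th
  elements of both orders to domain and range; the union of the resulting chain is the graph of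
  the isomorphism.
\<close>
theorem Cantor_back_and_forth:
  assumes A: "countable A" "unbounded_dense A" and B: "countable B" "unbounded_dense B"
    and p0: "partial_iso A B p0"
  shows "\<exists>F. strict_mono_on A F \<and> F ` A = B \<and> (\<forall>(a, b)\<in>p0. F a = b)"
proof -
  have ne: "A \<noteq> {}" "B \<noteq> {}" using A B unfolding unbounded_dense_def by auto
  have "\<exists>p'. partial_iso A B p' \<and> p \<subseteq> p' \<and> from_nat_into A n \<in> Domain p'
      \<and> from_nat_into B n \<in> Range p'"
    if p: "partial_iso A B p" for p n
  proof -
    obtain p1 where p1: "partial_iso A B p1" "p \<subseteq> p1" "from_nat_into A n \<in> Domain p1"
      using partial_iso_extend_domain[OF B(2) p from_nat_into[OF ne(1)]] by blast
    obtain p2 where p2: "partial_iso A B p2" "p1 \<subseteq> p2" "from_nat_into B n \<in> Range p2"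
      using partial_iso_extend_range[OF A(2) p1(1) from_nat_into[OF ne(2)]] by blast
    show ?thesis using p1 p2 by blast
  qed
  then obtain p where p: "\<And>n. partial_iso A B (p n)" "p 0 = p0"
    and step: "\<And>n. p n \<subseteq> p (Suc n) \<and> from_nat_into A n \<in> Domain (p (Suc n))
      \<and> from_nat_into B n \<in> Range (p (Suc n))"
    using dependent_nat_choice[of "\<lambda>n p. partial_iso A B p \<and> (n = 0 \<longrightarrow> p = p0)"
        "\<lambda>n p p'. p \<subseteq> p' \<and> from_nat_into A n \<in> Domain p' \<and> from_nat_into B n \<in> Range p'"] p0
    by (metis nat.simps(3))
  have chain: "p m \<subseteq> p n" if "m \<le> n" for m n
    using lift_Suc_mono_le[of p, OF _ that] step by blast
  define R where "R = (\<Union>n. p n)"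
  have R: "a < a' \<longleftrightarrow> b < b'" if "(a, b) \<in> R" "(a', b') \<in> R" for a b a' b'
  proof -
    obtain m n where "(a, b) \<in> p m" "(a', b') \<in> p n" using \<open>(a, b) \<in> R\<close> \<open>(a', b') \<in> R\<close> R_def by auto
    then have "(a, b) \<in> p (max m n)" "(a', b') \<in> p (max m n)"
      using chain[of m "max m n"] chain[of n "max m n"] by auto
    then show ?thesis using partial_iso_less_iff[OF p(1)] by blast
  qed
  have RAB: "R \<subseteq> A \<times> B" using p(1) unfolding R_def partial_iso_def by blast
  have dom: "\<exists>b. (a, b) \<in> R" if "a \<in> A" for a
  proof -
    obtain n where "from_nat_into A n = a" using from_nat_into_surj[OF A(1) \<open>a \<in> A\<close>] by blast
    then show ?thesis using step[of n] unfolding R_def by blast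
  qed
  have ran: "\<exists>a. (a, b) \<in> R" if "b \<in> B" for b
  proof -
    obtain n where "from_nat_into B n = b" using from_nat_into_surj[OF B(1) \<open>b \<in> B\<close>] by blast
    then show ?thesis using step[of n] unfolding R_def by blast
  qed
  obtain F where F: "\<And>a. a \<in> A \<Longrightarrow> (a, F a) \<in> R" using dom by metis
  have graph: "F a = b" if "(a, b) \<in> R" for a b
  proof -
    have "(a, F a) \<in> R" using F RAB that by blast
    then show ?thesis using R[of a "F a" a b] R[of a b a "F a"] that by force
  qed
  have "strict_mono_on A F" using F R by (meson strict_mono_onI)
  moreover have "F ` A = B" using F RAB ran graph by (auto simp: image_iff) blast
  moreover have "\<forall>(a, b)\<in>p0. F a = b" using graph p(2) unfolding R_def by blast
  ultimately show ?thesis by blast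
qed

lemma unbounded_dense_UNIV: "unbounded_dense (UNIV :: 'a::unbounded_dense_linorder set)"
  unfolding unbounded_dense_def by (auto intro: lt_ex gt_ex dense)

lemma unbounded_dense_lex: "unbounded_dense (UNIV :: (rat \<times> rat) set)"
proof -
  have "\<exists>z. x < z \<and> z < y" if lt: "x < y" for x y :: "rat \<times> rat"
  proof (cases "fst x < fst y")
    case True
    then show ?thesis by (intro exI[of _ "(fst x, snd x + 1)"]) (simp add: less_prod_def)
  next
    case False
    then have "fst x = fst y" "snd x < snd y" using lt by (auto simp: less_prod_def)
    then show ?thesis by (intro exI[of _ "(fst x, (snd x + snd y) / 2)"]) (simp add: less_prod_def)
  qed
  moreover have "\<exists>y. y < x" for x :: "rat \<times> rat"
    by (intro exI[of _ "(fst x, snd x - 1)"]) (simp add: less_prod_def)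
  moreover have "\<exists>y. x < y" for x :: "rat \<times> rat"
    by (intro exI[of _ "(fst x, snd x + 1)"]) (simp add: less_prod_def)
  ultimately show ?thesis unfolding unbounded_dense_def by blast
qed

section \<open>Comparing strictly increasing maps with the lexicographic square\<close>

text \<open>
  Every fibre of \<open>P\<close> is a convex set of rationals without end points, hence by Cantor's theorem a
  copy of \<open>\<rat>\<close> in which \<open>s y\<close> can be made the origin. Placing the fibres side by side in the order
  of the values of \<open>P\<close> yields the lexicographic square.
\<close>
lemma lex_iso_from_section:
  fixes P :: "rat \<Rightarrow> rat"
  assumes P: "mono P" and s: "\<And>y. P (s y) = y"
    and no_ends: "\<And>q. \<exists>r r'. r < q \<and> q < r' \<and> P r = P q \<and> P r' = P q"
  shows "\<exists>\<Theta> :: rat \<times> rat \<Rightarrow> rat. strict_mono \<Theta> \<and> surj \<Theta> \<and> (\<forall>y. \<Theta> (y, 0) = s y)"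
proof -
  have "\<exists>\<gamma>. strict_mono_on UNIV \<gamma> \<and> range \<gamma> = {q. P q = y} \<and> \<gamma> (0::rat) = s y" for y
  proof -
    have "\<exists>z. P z = y \<and> a < z \<and> z < b" if "P a = y" "P b = y" "a < b" for a b
    proof -
      obtain z where z: "a < z" "z < b" using dense \<open>a < b\<close> by blast
      then have "P a \<le> P z" "P z \<le> P b" using P by (simp_all add: monoD)
      then show ?thesis using z that by auto
    qed
    then have "unbounded_dense {q. P q = y}"
      unfolding unbounded_dense_def using s no_ends by blast
    moreover have "partial_iso UNIV {q. P q = y} {(0::rat, s y)}"
      using s by (auto simp: partial_iso_def)
    ultimately show ?thesis
      using Cantor_back_and_forth[of "UNIV :: rat set" "{q. P q = y}" "{(0, s y)}"]
        unbounded_dense_UNIV by auto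
  qed
  then obtain \<gamma> :: "rat \<Rightarrow> rat \<Rightarrow> rat" where \<gamma>: "\<And>y. strict_mono (\<gamma> y)" "\<And>y. range (\<gamma> y) = {q. P q = y}" "\<And>y. \<gamma> y 0 = s y"
    by metis
  have P\<gamma>: "P (\<gamma> y t) = y" for y t using \<gamma>(2) by blast
  define \<Theta> where "\<Theta> = (\<lambda>(y, t). \<gamma> y t)"
  have "strict_mono \<Theta>"
  proof (rule strict_monoI)
    fix v w :: "rat \<times> rat" assume "v < w"
    then have "fst v < fst w \<or> fst v = fst w \<and> snd v < snd w" by (auto simp: less_prod_def)
    then consider "fst v < fst w" | "fst v = fst w" "snd v < snd w" by blast
    then show "\<Theta> v < \<Theta> w"
    proof cases
      case 1
      then have "\<not> P (\<Theta> w) \<le> P (\<Theta> v)" by (simp add: \<Theta>_def case_prod_beta P\<gamma>)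
      then show ?thesis using P by (meson monoD not_le)
    next
      case 2
      then show ?thesis using \<gamma>(1) by (simp add: \<Theta>_def case_prod_beta strict_mono_less)
    qed
  qed
  moreover have "surj \<Theta>"
  proof (rule surjI)
    show "\<Theta> (P q, inv_into UNIV (\<gamma> (P q)) q) = q" for q
      using \<gamma>(2)[of "P q"] by (simp add: \<Theta>_def f_inv_into_f)
  qed
  ultimately show ?thesis using \<gamma>(3) by (auto simp: \<Theta>_def)
qed

text \<open>
  Each rational \<open>q\<close> of the codomain defines a real cut \<open>c q\<close> in the domain of \<open>f\<close>, namely the
  supremum of the \<open>r\<close> with \<open>f r \<le> q\<close>. The set of these cuts is countable and contains \<open>\<rat>\<close>,
  because \<open>c (f r) = r\<close>, so it is isomorphic to the lexicographic square. The map \<open>P\<close> sends \<open>q\<close> to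
  the first coordinate of \<open>c q\<close>. A column of the square is an open convex set of cuts and therefore
  contains rationals on both sides of \<open>c q\<close>, which is why every fibre of \<open>P\<close> has points of the image
  of \<open>f\<close> on both sides of \<open>q\<close>. Three values are prescribed so that a window around \<open>x\<close> is kept track of.
\<close>
lemma collapse_to_rationals:
  fixes f :: "rat \<Rightarrow> rat"
  assumes f: "strict_mono f" and cofinal: "\<And>q. \<exists>r. q \<le> f r" "\<And>q. \<exists>r. f r \<le> q"
  shows "\<exists>P. mono P \<and> P (f (x - 1)) = -1 \<and> P (f x) = 0 \<and> P (f (x + 1)) = 1
    \<and> (\<forall>y::rat. \<exists>q. P q = y)
    \<and> (\<forall>q. \<exists>r r'. f r < q \<and> q < f r' \<and> P (f r) = P q \<and> P (f r') = P q)"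
proof -
  define S where "S q = real_of_rat ` {r. f r \<le> q}" for q
  define c where "c q = Sup (S q)" for q
  have ne: "S q \<noteq> {}" for q using cofinal(2) by (auto simp: S_def)
  have bdd: "bdd_above (S q)" for q
  proof -
    obtain r where "q \<le> f r" using cofinal(1) by blast
    then have "s \<le> r" if "f s \<le> q" for s using that f by (meson order_trans strict_mono_less_eq)
    then show ?thesis by (auto simp: S_def of_rat_less_eq intro!: bdd_aboveI[of _ "real_of_rat r"])
  qed
  have cf: "c (f r) = of_rat r" for r
    unfolding c_def by (rule cSup_eq_maximum) (use f in \<open>auto simp: S_def strict_mono_less_eq of_rat_less_eq\<close>)
  have mono_c: "c q \<le> c q'" if "q \<le> q'" for q q'
    unfolding c_def by (rule cSup_subset_mono[OF ne bdd]) (use that in \<open>auto simp: S_def\<close>)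
  let ?C = "range c"
  let ?p = "{(c (f (x - 1)), (-1::rat, 0::rat)), (c (f x), (0, 0)), (c (f (x + 1)), (1, 0))}"
  have sub: "of_rat r \<in> ?C" for r using cf by (metis rangeI)
  have between: "\<exists>z\<in>?C. a < z \<and> z < b" if "a < b" for a b
    using of_rat_dense[OF that] sub by blast
  have "\<exists>z\<in>?C. z < a" "\<exists>z\<in>?C. a < z" for a
    using between[of "a - 1" a] between[of a "a + 1"] by auto
  with between have "unbounded_dense ?C"
    unfolding unbounded_dense_def by blast
  moreover have "partial_iso ?C UNIV ?p"
    using sub by (auto simp: partial_iso_def cf less_prod_def of_rat_less)
  ultimately obtain \<psi> where "strict_mono_on ?C \<psi>" and \<psi>sur: "\<psi> ` ?C = (UNIV :: (rat \<times> rat) set)"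
    and \<psi>p: "\<forall>(a, b)\<in>?p. \<psi> a = b"
    using Cantor_back_and_forth[of ?C "UNIV :: (rat \<times> rat) set" ?p] unbounded_dense_lex by auto
  then have \<psi>: "\<psi> a < \<psi> b \<longleftrightarrow> a < b" if "a \<in> ?C" "b \<in> ?C" for a b
    using that by (meson strict_mono_on_less)
  have \<psi>le: "\<psi> a \<le> \<psi> b \<longleftrightarrow> a \<le> b" if "a \<in> ?C" "b \<in> ?C" for a b
    using \<psi>[OF that(2,1)] by (meson not_le)
  define P where "P q = fst (\<psi> (c q))" for q
  have "mono P"
  proof (rule monoI)
    fix q q' :: rat assume "q \<le> q'"
    then have "\<psi> (c q) \<le> \<psi> (c q')" using \<psi>le mono_c by blast
    then show "P q \<le> P q'" unfolding P_def less_eq_prod_def by auto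
  qed
  moreover have "P (f (x - 1)) = -1 \<and> P (f x) = 0 \<and> P (f (x + 1)) = 1"
    using \<psi>p by (simp add: P_def)
  moreover have "\<exists>q. P q = y" for y
  proof -
    obtain q where "\<psi> (c q) = (y, 0)" using \<psi>sur by (metis UNIV_I imageE)
    then show ?thesis unfolding P_def by (metis fst_conv)
  qed
  moreover have "\<exists>r r'. f r < q \<and> q < f r' \<and> P (f r) = P q \<and> P (f r') = P q" for q
  proof -
    obtain a t where at: "\<psi> (c q) = (a, t)" by fastforce
    obtain d where d: "d \<in> ?C" "\<psi> d = (a, t - 1)" using \<psi>sur by (metis UNIV_I imageE)
    obtain e where e: "e \<in> ?C" "\<psi> e = (a, t + 1)" using \<psi>sur by (metis UNIV_I imageE)
    have "d < c q" "c q < e" using d e at \<psi>[of d "c q"] \<psi>[of "c q" e] by (auto simp: less_prod_def)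
    then obtain r r' where r: "d < of_rat r" "of_rat r < c q" and r': "c q < of_rat r'" "of_rat r' < e"
      using of_rat_dense by metis
    have "f r < q" using mono_c[of q "f r"] r cf by (metis not_le)
    moreover have "q < f r'" using mono_c[of "f r'" q] r' cf by (metis not_le)
    moreover have "P (f r) = a"
      using \<psi>[OF d(1) sub[of r]] \<psi>[OF sub[of r], of "c q"] r d(2) at
      by (auto simp: P_def cf less_prod_def)
    moreover have "P (f r') = a"
      using \<psi>[OF sub[of r'] e(1)] \<psi>[of "c q", OF _ sub[of r']] r' e(2) at
      by (auto simp: P_def cf less_prod_def)
    ultimately show ?thesis using at by (metis P_def fst_conv)
  qed
  ultimately show ?thesis by blast
qed

text \<open>
  One collapsing map \<open>P\<close> serves two purposes: if \<open>w\<close> selects \<open>w y\<close> with \<open>P (F (w y)) = y\<close>, then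
  \<open>F \<circ> w\<close> is a section of \<open>P\<close> and \<open>w\<close> is a section of \<open>P \<circ> F\<close>. So both \<open>w\<close> and \<open>F \<circ> w\<close> look
  like the central line of a lexicographic square. As the collapse needs a map whose image is
  unbounded on both sides, it is applied not to \<open>f\<close> but to a map \<open>F\<close> that agrees with \<open>f\<close> near
  \<open>x\<close>; this is why the equation is claimed only for \<open>-1 < y < 1\<close>.
\<close>
lemma lex_square_factorization:
  fixes f :: "rat \<Rightarrow> rat"
  assumes f: "strict_mono f"
  shows "\<exists>(\<Theta> :: rat \<times> rat \<Rightarrow> rat) (\<Theta>' :: rat \<times> rat \<Rightarrow> rat). strict_mono \<Theta> \<and> surj \<Theta> \<and> strict_mono \<Theta>' \<and> surj \<Theta>'
    \<and> \<Theta>' (0, 0) = x \<and> (\<forall>y. -1 < y \<and> y < 1 \<longrightarrow> f (\<Theta>' (y, 0)) = \<Theta> (y, 0))"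
proof -
  \<comment> \<open>Outside the unit window around \<open>x\<close> the map is continued by translations.\<close>
  define F where "F r = (if r < x - 1 then f (x - 1) + (r - (x - 1))
     else if r \<le> x + 1 then f r else f (x + 1) + (r - (x + 1)))" for r
  have "strict_mono F"
  proof (rule strict_monoI)
    fix a b :: rat assume ab: "a < b"
    have le: "f u \<le> f v" if "u \<le> v" for u v using that f by (simp add: strict_mono_less_eq)
    have "f a < f b" using ab f by (simp add: strict_mono_less)
    then show "F a < F b"
      using ab le[of "x - 1" b] le[of a "x + 1"] le[of "x - 1" "x + 1"] unfolding F_def by auto
  qed
  moreover have "\<exists>r. q \<le> F r" for q
    by (rule exI[of _ "max (x + 2) (q - f (x + 1) + x + 1)"]) (auto simp: F_def max_def)
  moreover have "\<exists>r. F r \<le> q" for q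
    by (rule exI[of _ "min (x - 2) (q - f (x - 1) + x - 1)"]) (auto simp: F_def min_def)
  ultimately obtain P where P: "mono P" "P (F (x - 1)) = -1" "P (F x) = 0" "P (F (x + 1)) = 1"
    and sur: "\<And>y::rat. \<exists>q. P q = y"
    and ends: "\<And>q. \<exists>r r'. F r < q \<and> q < F r' \<and> P (F r) = P q \<and> P (F r') = P q"
    using collapse_to_rationals[of F x] by blast
  have Fless: "F a < F b \<longleftrightarrow> a < b" for a b using \<open>strict_mono F\<close> by (simp add: strict_mono_less)
  have PF: "mono (\<lambda>r. P (F r))" using P(1) \<open>strict_mono F\<close> by (simp add: mono_def strict_mono_less_eq)
  have "\<exists>r. P (F r) = y \<and> (y = 0 \<longrightarrow> r = x)" for y
    using P(3) sur[of y] ends by (cases "y = 0") metis+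
  then obtain w where w: "\<And>y. P (F (w y)) = y" "w 0 = x" by metis
  obtain \<Theta> :: "rat \<times> rat \<Rightarrow> rat" where \<Theta>: "strict_mono \<Theta>" "surj \<Theta>" "\<And>y. \<Theta> (y, 0) = F (w y)"
    using lex_iso_from_section[OF P(1), of "\<lambda>y. F (w y)"] w(1) ends by blast
  have "\<exists>r r'. r < q \<and> q < r' \<and> P (F r) = P (F q) \<and> P (F r') = P (F q)" for q
    using ends[of "F q"] Fless by blast
  then obtain \<Theta>' :: "rat \<times> rat \<Rightarrow> rat" where \<Theta>': "strict_mono \<Theta>'" "surj \<Theta>'" "\<And>y. \<Theta>' (y, 0) = w y"
    using lex_iso_from_section[OF PF, of w] w(1) by blast
  have "f (w y) = F (w y)" if "-1 < y" "y < 1" for y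
  proof -
    have "\<not> w y \<le> x - 1" using monoD[OF PF, of "w y" "x - 1"] w(1) P(2) that by auto
    moreover have "\<not> x + 1 \<le> w y" using monoD[OF PF, of "x + 1" "w y"] w(1) P(4) that by auto
    ultimately show ?thesis by (simp add: F_def)
  qed
  then have "f (\<Theta>' (y, 0)) = \<Theta> (y, 0)" if "-1 < y" "y < 1" for y
    using that by (simp add: \<Theta>(3) \<Theta>'(3))
  moreover have "\<Theta>' (0, 0) = x" by (simp add: \<Theta>'(3) w(2))
  ultimately show ?thesis using \<Theta>(1,2) \<Theta>'(1,2) by blast
qed

section \<open>Rigidity of the embedding of the monoid\<close>

lemma strict_mono_surj_in_Aut_less: "strict_mono g \<Longrightarrow> surj g \<Longrightarrow> g \<in> carrier Aut_less"
  by (simp add: Aut_less_def bij_def strict_mono_imp_inj_on strict_mono_less)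

lemma transported_in_Aut_less:
  fixes F G :: "'a::linorder \<Rightarrow> rat"
  assumes F: "strict_mono F" "surj F" and G: "strict_mono G" "surj G"
  shows "F \<circ> inv_into UNIV G \<in> carrier Aut_less"
proof (rule strict_mono_surj_in_Aut_less)
  have G': "G (inv_into UNIV G a) = a" for a using G(2) by (simp add: surj_f_inv_f)
  show "strict_mono (F \<circ> inv_into UNIV G)"
  proof (rule strict_monoI)
    fix a b :: rat assume "a < b"
    then have "inv_into UNIV G a < inv_into UNIV G b" using G' strict_mono_less[OF G(1)] by metis
    then show "(F \<circ> inv_into UNIV G) a < (F \<circ> inv_into UNIV G) b" using F(1) by (simp add: strict_mono_less)
  qed
  show "surj (F \<circ> inv_into UNIV G)" 
    using F(2) G(1) by (intro comp_surj inj_imp_surj_inv strict_mono_imp_inj_on)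
qed

text \<open>
  On the columns over \<open>(-1, 1)\<close> the first coordinate is moved by the conjugate under \<open>k\<close> of the
  dilation about \<open>x\<close>, and the second one is doubled; so a fixed point there must lie over \<open>k x\<close> and
  have second coordinate \<open>0\<close>. The remaining columns are shifted along themselves, which leaves no
  fixed point.
\<close>
lemma lex_expansion:
  fixes k :: "rat \<Rightarrow> rat"
  assumes k: "strict_mono k" "range k = {-1<..<1}"
  shows "\<exists>h :: rat \<times> rat \<Rightarrow> rat \<times> rat. strict_mono h \<and> surj h
    \<and> (\<forall>y. h (k y, 0) = (k (2 * y - x), 0)) \<and> (\<forall>v. h v = v \<longrightarrow> v = (k x, 0))"
proof -
  define b where "b y = k (2 * inv_into UNIV k y - x)" for y
  have inj: "inj k" using k(1) by (rule strict_mono_imp_inj_on)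
  have bk: "b (k y) = k (2 * y - x)" for y using inj by (simp add: b_def)
  have k_range: "\<bar>k y\<bar> < 1" for y
  proof -
    have "k y \<in> {-1<..<1}" using k(2) by blast
    then show ?thesis by auto
  qed
  have ex: "\<exists>z. y = k z" if "\<bar>y\<bar> < 1" for y
  proof -
    have "y \<in> range k" using that k(2) by (auto simp: abs_less_iff)
    then show ?thesis by blast
  qed
  have b_in: "\<bar>b y\<bar> < 1" for y unfolding b_def by (rule k_range)
  have b_less: "b y < b z" if "\<bar>y\<bar> < 1" "\<bar>z\<bar> < 1" "y < z" for y z
    using ex[OF that(1)] ex[OF that(2)] that(3) k(1) by (auto simp: bk strict_mono_less)
  define h :: "rat \<times> rat \<Rightarrow> rat \<times> rat"
    where "h = (\<lambda>(y, t). if \<bar>y\<bar> < 1 then (b y, 2 * t) else (y, t + 1))"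
  have "strict_mono h"
  proof (rule strict_monoI)
    fix v w :: "rat \<times> rat" assume "v < w"
    obtain y t z s where vw: "v = (y, t)" "w = (z, s)" by fastforce
    have "y < z \<or> y = z \<and> t < s" using \<open>v < w\<close> vw by (auto simp: less_prod_def)
    then show "h v < h w"
      using b_less[of y z] b_in[of y] b_in[of z] vw by (auto simp: h_def less_prod_def)
  qed
  moreover have "surj h"
  proof -
    have "\<exists>v. h v = (y, t)" for y t
    proof (cases "\<bar>y\<bar> < 1")
      case True
      then obtain z where z: "y = k z" using ex by blast
      have "2 * ((z + x) / 2) - x = z" by (simp add: field_simps)
      then have "h (k ((z + x) / 2), t / 2) = (y, t)" by (simp add: h_def bk k_range z del: times_divide_eq_right)
      then show ?thesis by blast
    next
      case False
      then have "h (y, t - 1) = (y, t)" by (simp add: h_def)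
      then show ?thesis by blast
    qed
    then show ?thesis unfolding surj_def by (metis surj_pair)
  qed
  moreover have "h (k y, 0) = (k (2 * y - x), 0)" for y
    by (simp add: h_def bk k_range)
  moreover have "v = (k x, 0)" if "h v = v" for v
  proof -
    obtain y t where v: "v = (y, t)" by fastforce
    show ?thesis
    proof (cases "\<bar>y\<bar> < 1")
      case True
      then obtain z where z: "y = k z" using ex by blast
      then have eq: "k (2 * z - x) = k z" and "t = 0" using that v True by (auto simp: h_def bk)
      moreover have "z = x" using injD[OF inj eq] by simp
      ultimately show ?thesis using v z by simp
    next
      case False
      then show ?thesis using that v by (simp add: h_def)
    qed
  qed
  ultimately show ?thesis by blast
qed

theorem corollary2p5:
  fixes \<xi> :: "(rat \<Rightarrow> rat) \<Rightarrow> (rat \<Rightarrow> rat)"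
  assumes "\<xi> \<in> monoid_hom End_less End_le"
    and "inj_on \<xi> (carrier End_less)"
    and "\<And>g. g \<in> carrier Aut_less \<Longrightarrow> \<xi> g = g"
  shows "\<forall>f \<in> carrier End_less. \<xi> f = f"
proof -
  have comp: "\<xi> (f \<circ> g) = \<xi> f \<circ> \<xi> g" if "strict_mono f" "strict_mono g" for f g
    using assms(1) that by (auto simp: monoid_hom_def hom_def End_less_def End_le_def)
  have Aut_mono: "strict_mono g" if "g \<in> carrier Aut_less" for g
    using that by (auto simp: Aut_less_def strict_mono_def)
  have "unbounded_dense {-1<..<1::rat}"
  proof -
    have "\<exists>y\<in>{-1<..<1}. y < a" if "a \<in> {-1<..<1}" for a :: rat
      using that dense[of "-1" a] by fastforce
    moreover have "\<exists>y\<in>{-1<..<1}. a < y" if "a \<in> {-1<..<1}" for a :: rat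
      using that dense[of a 1] by fastforce
    moreover have "\<exists>z\<in>{-1<..<1}. a < z \<and> z < b" if "a \<in> {-1<..<1}" "b \<in> {-1<..<1}" "a < b" for a b :: rat
      using that dense[of a b] by fastforce
    ultimately show ?thesis unfolding unbounded_dense_def by simp
  qed
  moreover have "partial_iso (UNIV :: rat set) {-1<..<1::rat} {(0, 0)}"
    by (auto simp: partial_iso_def)
  ultimately obtain k :: "rat \<Rightarrow> rat" where k: "strict_mono k" "range k = {-1<..<1}" "k 0 = 0"
    using Cantor_back_and_forth[of "UNIV :: rat set" "{-1<..<1::rat}" "{(0, 0)}"] unbounded_dense_UNIV
    by auto
  have "partial_iso (UNIV :: (rat \<times> rat) set) (UNIV :: rat set) {}"
    by (simp add: partial_iso_def)
  then obtain L :: "rat \<times> rat \<Rightarrow> rat" where L: "strict_mono L" "surj L"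
    using Cantor_back_and_forth[of "UNIV :: (rat \<times> rat) set" "UNIV :: rat set" "{}"]
      unbounded_dense_UNIV unbounded_dense_lex by auto
  have invL: "inv_into UNIV L (L v) = v" for v using L(1) by (simp add: strict_mono_imp_inj_on)
  define u where "u y = L (k y, 0)" for y
  have u_mono: "strict_mono u"
    using L(1) k(1) by (auto simp: u_def strict_mono_def less_prod_def)
  have \<xi>u: "\<xi> u = u"
  proof
    fix x
    obtain h :: "rat \<times> rat \<Rightarrow> rat \<times> rat" where h: "strict_mono h" "surj h" "\<And>y. h (k y, 0) = (k (2 * y - x), 0)"
      "\<And>v. h v = v \<Longrightarrow> v = (k x, 0)"
      using lex_expansion[OF k(1,2), of x] by blast
    define H where "H = (L \<circ> h) \<circ> inv_into UNIV L"
    define g where "g y = 2 * y - x" for y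
    have "strict_mono (L \<circ> h)"
      using L(1) h(1) by (intro strict_monoI) (simp add: strict_mono_less)
    then have H: "H \<in> carrier Aut_less"
      unfolding H_def using comp_surj[OF h(2) L(2)] L by (rule transported_in_Aut_less)
    have g: "g \<in> carrier Aut_less"
    proof (rule strict_mono_surj_in_Aut_less)
      show "strict_mono g" by (simp add: g_def strict_mono_def)
      show "surj g" by (rule surjI[of _ "\<lambda>y. (y + x) / 2"]) (simp add: g_def field_simps)
    qed
    have "H \<circ> u = u \<circ> g" by (auto simp: H_def u_def g_def invL h(3))
    \<comment> \<open>Since \<open>\<xi>\<close> fixes automorphisms, the intertwining relation passes from \<open>u\<close> to \<open>\<xi> u\<close>.\<close>
    then have "H \<circ> \<xi> u = \<xi> u \<circ> g"
      using comp[OF Aut_mono[OF H] u_mono] comp[OF u_mono Aut_mono[OF g]]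
      by (simp add: assms(3)[OF H] assms(3)[OF g])
    then have "H (\<xi> u x) = \<xi> u (g x)" by (metis comp_apply)
    also have "g x = x" by (simp add: g_def)
    finally have "H (\<xi> u x) = \<xi> u x" .
    moreover obtain v where v: "\<xi> u x = L v" using L(2) by (metis surjD)
    ultimately have "h v = v" using L(1) by (simp add: H_def invL strict_mono_eq)
    then show "\<xi> u x = u x" using h(4) v by (simp add: u_def)
  qed
  show ?thesis
  proof
    fix f assume "f \<in> carrier End_less"
    then have f: "strict_mono f" by (simp add: End_less_def)
    show "\<xi> f = f"
    proof
      fix x
      obtain \<Theta> \<Theta>' :: "rat \<times> rat \<Rightarrow> rat" where \<Theta>: "strict_mono \<Theta>" "surj \<Theta>" "strict_mono \<Theta>'" "surj \<Theta>'"
        "\<Theta>' (0, 0) = x" "\<And>y. -1 < y \<Longrightarrow> y < 1 \<Longrightarrow> f (\<Theta>' (y, 0)) = \<Theta> (y, 0)"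
        using lex_square_factorization[OF f, of x] by blast
      define \<theta> where "\<theta> = \<Theta> \<circ> inv_into UNIV L"
      define \<theta>' where "\<theta>' = \<Theta>' \<circ> inv_into UNIV L"
      have G: "\<theta> \<in> carrier Aut_less" "\<theta>' \<in> carrier Aut_less"
        unfolding \<theta>_def \<theta>'_def
        using transported_in_Aut_less[OF \<Theta>(1,2) L] transported_in_Aut_less[OF \<Theta>(3,4) L] by auto
      have "f (\<Theta>' (k y, 0)) = \<Theta> (k y, 0)" for y
      proof -
        have "k y \<in> {-1<..<1}" using k(2) by blast
        then show ?thesis using \<Theta>(6) by simp
      qed
      then have eq: "f \<circ> (\<theta>' \<circ> u) = \<theta> \<circ> u"
        by (simp add: fun_eq_iff \<theta>_def \<theta>'_def u_def invL)
      have \<theta>u: "\<xi> (\<theta>' \<circ> u) = \<theta>' \<circ> u" "\<xi> (\<theta> \<circ> u) = \<theta> \<circ> u"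
        using comp[OF Aut_mono[OF G(2)] u_mono] comp[OF Aut_mono[OF G(1)] u_mono]
        by (simp_all add: assms(3)[OF G(1)] assms(3)[OF G(2)] \<xi>u)
      have "strict_mono (\<theta>' \<circ> u)"
        using Aut_mono[OF G(2)] u_mono by (simp add: strict_mono_def)
      from comp[OF f this] have "\<xi> f \<circ> (\<theta>' \<circ> u) = f \<circ> (\<theta>' \<circ> u)"
        by (simp only: eq \<theta>u)
      moreover have "(\<theta>' \<circ> u) 0 = x" by (simp add: \<theta>'_def u_def invL k(3) \<Theta>(5))
      ultimately show "\<xi> f x = f x" by (metis comp_apply)
    qed
  qed
qed

end
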